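(* Let $\mathcal{D}$ be a Ryser design of Type-2 of order $v$, index $\lambda$ and replication numbers $r_1>r_2$, and let $c,d,a,x,y$ be as in the context. (a) If there exists a block $A$ of size $2\lambda+ta$ with $2tc+\lambda>e_2$, that is $t>x/2$, then $A$ is the unique block of $\mathcal{D}$ whose size is $2\lambda+sa$ for some $s>x/2$. (b) If there exists a block $B$ of size $2\lambda-ta$ with $2td+\lambda>e_1$, that is $t>y/2$, then $B$ is the unique block of $\mathcal{D}$ whose size is $2\lambda-sa$ for some $s>y/2$.
   Context: A Ryser design of order $v$ and index $\lambda$ is a pair $(X,L)$ where $X$ is a set of $v$ points and $L$ is a collection of $v$ subsets (blocks) of $X$ such that any two distinct blocks meet in exactly $\lambda$ points, every block has size $>\lambda$, and there exist two blocks of different sizes. It is known that there are integers $r_1>r_2$ with $r_1+r_2=v+1$ such that every point lies in exactly $r_1$ or exactly $r_2$ blocks. Let $e_i$ be the number of points with replication number $r_i$. Write $(r_1-1)/(r_2-1)=c/d$ with $\gcd(c,d)=1$ and $a=c-d$; every block size has the form $2\lambda+ta$ for an integer $t$. Then $c\mid e_2-\lambda$ and $d\mid e_1-\lambda$; set $x=(e_2-\lambda)/c$, $y=(e_1-\lambda)/d$. A symmetric $(v,k,\mu)$ design is a set of $v$ points with $v$ blocks each of size $k$, any two distinct blocks meeting in $\mu\ge1$ points, $k>\mu$; given such a design with block set $\mathcal{A}$ and a block $A$, the collection $\{A\}\cup\{A\triangle B:B\in\mathcal{A},B\ne A\}$ (when $k\ne 2\mu$) is a Ryser design, and Ryser designs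 obtained this way are of Type-1. A Ryser design is of Type-2 if it is not of Type-1. *)

theory Defs
  imports Complex_Main
begin

definition ryser_design :: "'p set \<Rightarrow> 'p set set \<Rightarrow> nat \<Rightarrow> nat \<Rightarrow> bool" where
  "ryser_design X L v lam \<longleftrightarrow>
     finite X \<and> card X = v \<and> L \<subseteq> Pow X \<and> card L = v \<and>
     (\<forall>A\<in>L. \<forall>B\<in>L. A \<noteq> B \<longrightarrow> card (A \<inter> B) = lam) \<and>
     (\<forall>A\<in>L. card A > lam) \<and>
     (\<exists>A\<in>L. \<exists>B\<in>L. card A \<noteq> card B)"

definition symmetric_design :: "'p set \<Rightarrow> 'p set set \<Rightarrow> nat \<Rightarrow> nat \<Rightarrow> nat \<Rightarrow> bool" where
  "symmetric_design X \<A> v k \<mu> \<longleftrightarrow>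
     finite X \<and> card X = v \<and> \<A> \<subseteq> Pow X \<and> card \<A> = v \<and>
     (\<forall>A\<in>\<A>. card A = k) \<and>
     (\<forall>A\<in>\<A>. \<forall>B\<in>\<A>. A \<noteq> B \<longrightarrow> card (A \<inter> B) = \<mu>) \<and>
     \<mu> \<ge> 1 \<and> k > \<mu>"

definition block_complementation :: "'p set set \<Rightarrow> 'p set \<Rightarrow> 'p set set" where
  "block_complementation \<A> A = {A} \<union> {sym_diff A B |B. B \<in> \<A> \<and> B \<noteq> A}"

definition ryser_type1 :: "'p set \<Rightarrow> 'p set set \<Rightarrow> nat \<Rightarrow> nat \<Rightarrow> bool" where
  "ryser_type1 X L v lam \<longleftrightarrow>
     ryser_design X L v lam \<and>
     (\<exists>\<A> A k \<mu>. symmetric_design X \<A> v k \<mu> \<and> k \<noteq> 2 * \<mu> \<and> A \<in> \<A> \<and>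
        L = block_complementation \<A> A)"

definition ryser_type2 :: "'p set \<Rightarrow> 'p set set \<Rightarrow> nat \<Rightarrow> nat \<Rightarrow> bool" where
  "ryser_type2 X L v lam \<longleftrightarrow> ryser_design X L v lam \<and> \<not> ryser_type1 X L v lam"

definition replication :: "'p set set \<Rightarrow> 'p \<Rightarrow> nat" where
  "replication L p = card {B \<in> L. p \<in> B}"

end

theory Submission
  imports Defs
begin

text \<open>
  Counting incidences between a block \<open>A\<close> and all blocks shows that a block of size
  \<open>2\<lambda> + ta\<close> has \<open>\<lambda> - td\<close> points of replication \<open>r\<^sub>1\<close> and \<open>\<lambda> + tc\<close> points of replication
  \<open>r\<^sub>2\<close>. Two blocks with parameters \<open>s, t > x / 2\<close> together contain more than \<open>e\<^sub>2 + \<lambda>\<close> points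
  of replication \<open>r\<^sub>2\<close>, so more than \<open>\<lambda>\<close> of these lie in both blocks and the blocks coincide.
  Part (b) is the same with the points of replication \<open>r\<^sub>1\<close>.
\<close>

lemma sum_replication:
  assumes "finite L" "finite A"
  shows "(\<Sum>p\<in>A. replication L p) = (\<Sum>B\<in>L. card (A \<inter> B))"
proof -
  have "(\<Sum>p\<in>A. card {B \<in> L. p \<in> B}) = (\<Sum>B\<in>L. card {p \<in> A. p \<in> B})"
    using assms by (intro sum_multicount_gen) auto
  then show ?thesis
    by (simp add: replication_def Int_def)
qed

lemma card_Int_pigeonhole:
  assumes "finite A" "finite B" "finite E"
  shows "card (A \<inter> E) + card (B \<inter> E) \<le> card E + card (A \<inter> B)"
proof -
  have "card (A \<inter> E) + card (B \<inter> E)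
      = card ((A \<inter> E) \<union> (B \<inter> E)) + card ((A \<inter> E) \<inter> (B \<inter> E))"
    using assms by (intro card_Un_Int) auto
  also have "\<dots> \<le> card E + card (A \<inter> B)"
    using assms by (intro add_mono card_mono) auto
  finally show ?thesis .
qed

lemma ryser_block_eqI:
  assumes D: "ryser_design X L v lam" and A: "A \<in> L" and B: "B \<in> L" and E: "E \<subseteq> X"
    and gt: "card (A \<inter> E) + card (B \<inter> E) > card E + lam"
  shows "A = B"
proof (rule ccontr)
  assume "A \<noteq> B"
  then have "card (A \<inter> B) = lam"
    using D A B by (auto simp: ryser_design_def)
  moreover have "finite A" "finite B" "finite E"
    using D A B E by (auto simp: ryser_design_def intro: finite_subset)
  ultimately show False
    using card_Int_pigeonhole[of A B E] gt by linarith
qed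

text \<open>Count the pairs of a point of \<open>A\<close> and a block through it: \<open>A\<close>
  itself contributes \<open>card A\<close>, which the \<open>- 1\<close> in each summand absorbs,
  and each of the other \<open>v - 1\<close> blocks contributes \<open>lam\<close>.\<close>

lemma ryser_block_replication_sum:
  assumes D: "ryser_design X L v lam" and A: "A \<in> L"
  shows "(\<Sum>p\<in>A. int (replication L p) - 1) = int lam * (int v - 1)"
proof -
  have fX: "finite X" and LX: "L \<subseteq> Pow X" and cL: "card L = v"
    and lam: "\<And>B. B \<in> L - {A} \<Longrightarrow> card (A \<inter> B) = lam"
    using D A by (auto simp: ryser_design_def)
  have fL: "finite L" and fA: "finite A"
    using fX LX A by (auto intro: finite_subset)
  \<comment> \<open>This makes the truncated difference \<open>v - 1\<close> agree with the integer
    one below.\<close>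
  have v: "v \<ge> 1"
    using cL A fL by (metis One_nat_def Suc_leI card_gt_0_iff empty_iff)
  have "(\<Sum>p\<in>A. replication L p) = card A + (\<Sum>B\<in>L - {A}. card (A \<inter> B))"
    using sum_replication[OF fL fA] A fL by (simp add: sum.remove)
  also have "(\<Sum>B\<in>L - {A}. card (A \<inter> B)) = (v - 1) * lam"
    using lam cL A fL by simp
  finally have "int (\<Sum>p\<in>A. replication L p) = int (card A) + (int v - 1) * int lam"
    using v by (simp add: of_nat_diff)
  then show ?thesis
    by (simp add: sum_subtractf mult.commute)
qed

lemma replication_ratioD:
  fixes r1 r2 c d :: nat
  assumes "r1 > r2" "c > 0" "d > 0"
    and ratio: "(real r1 - 1) / (real r2 - 1) = real c / real d"
  shows "r2 > 1" "c > d" "(int r1 - 1) * int d = (int r2 - 1) * int c"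
proof -
  \<comment> \<open>Positivity of the quotient excludes both small values of \<open>r2\<close>: for
    \<open>r2 = 1\<close> the quotient is 0 by the convention on division by zero, and for
    \<open>r2 = 0\<close> the denominator is negative while the numerator is not.\<close>
  have pos: "(real r1 - 1) / (real r2 - 1) > 0"
    using assms by simp
  then have ne: "real r2 - 1 \<noteq> 0"
    by auto
  show r2: "r2 > 1"
    using pos assms(1) by (cases r2) (auto simp: zero_less_divide_iff)
  have "(real r1 - 1) * real d = (real r2 - 1) * real c"
    using ratio ne assms(3) by (simp add: field_simps)
  then have "real_of_int ((int r1 - 1) * int d) = real_of_int ((int r2 - 1) * int c)"
    by simp
  then show eq: "(int r1 - 1) * int d = (int r2 - 1) * int c"
    by (simp only: of_int_eq_iff)
  have "(int r2 - 1) * int d < (int r2 - 1) * int c"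
    unfolding eq[symmetric] using assms(1,3) by (intro mult_strict_right_mono) auto
  then show "c > d"
    using r2 by (simp add: mult_less_cancel_left)
qed

text \<open>The block size and the weighted count over \<open>A\<close> give two linear equations
  for the two cardinalities. They have a unique solution because \<open>c > d\<close>. The integer
  \<open>t\<close> may be negative.\<close>

lemma ryser_block_parts:
  fixes t :: int
  assumes D: "ryser_design X L v lam" and A: "A \<in> L"
    and ord: "r1 > r2" and sum: "r1 + r2 = v + 1"
    and pts: "\<forall>p\<in>X. replication L p = r1 \<or> replication L p = r2"
    and pos: "c > 0" "d > 0"
    and ratio: "(real r1 - 1) / (real r2 - 1) = real c / real d"
    and size: "int (card A) = 2 * int lam + t * (int c - int d)"
  shows "int (card (A \<inter> {p \<in> X. replication L p = r1})) = int lam - t * int d"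
    and "int (card (A \<inter> {p \<in> X. replication L p = r2})) = int lam + t * int c"
proof -
  define A1 where "A1 = A \<inter> {p \<in> X. replication L p = r1}"
  define A2 where "A2 = A \<inter> {p \<in> X. replication L p = r2}"
  define n1 n2 where "n1 = int (card A1)" and "n2 = int (card A2)"
  define R1 R2 where "R1 = int r1 - 1" and "R2 = int r2 - 1"
  have AX: "A \<subseteq> X" and fA: "finite A"
    using D A by (auto simp: ryser_design_def intro: finite_subset)
  have split: "A = A1 \<union> A2" "A1 \<inter> A2 = {}" and fin: "finite A1" "finite A2"
    using AX pts ord fA by (auto simp: A1_def A2_def)
  have card: "n1 + n2 = int (card A)"
    using split fin by (simp add: n1_def n2_def card_Un_disjoint)
  have "(\<Sum>p\<in>A. int (replication L p) - 1)
      = (\<Sum>p\<in>A1. int (replication L p) - 1) + (\<Sum>p\<in>A2. int (replication L p) - 1)"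
    by (subst split(1)) (rule sum.union_disjoint[OF fin split(2)])
  also have "(\<Sum>p\<in>A1. int (replication L p) - 1) = n1 * R1"
    by (simp add: A1_def n1_def R1_def)
  also have "(\<Sum>p\<in>A2. int (replication L p) - 1) = n2 * R2"
    by (simp add: A2_def n2_def R2_def)
  also have "(\<Sum>p\<in>A. int (replication L p) - 1) = int lam * (R1 + R2)"
  proof -
    \<comment> \<open>With this the weighted count becomes homogeneous in \<open>R1\<close> and
      \<open>R2\<close>, so only their ratio matters.\<close>
    have "R1 + R2 = int v - 1"
      using sum by (simp add: R1_def R2_def)
    then show ?thesis
      using ryser_block_replication_sum[OF D A] by simp
  qed
  finally have count: "int lam * (R1 + R2) = n1 * R1 + n2 * R2" .
  have R2: "R2 > 0" and cd: "c > d" and R: "R1 * int d = R2 * int c"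
    using replication_ratioD[OF ord pos ratio] by (auto simp: R1_def R2_def)
  \<comment> \<open>Multiply \<open>count\<close> by \<open>d\<close> and replace
    \<open>R1 * d\<close> by \<open>R2 * c\<close>; then \<open>R2\<close> cancels.\<close>
  have "R2 * (n1 * int c + n2 * int d) = R2 * (int lam * (int c + int d))"
    using count R by algebra
  then have lin: "n1 * int c + n2 * int d = int lam * (int c + int d)"
    using R2 by simp
  \<comment> \<open>Subtracting \<open>d\<close> times the size equation from \<open>lin\<close>
    eliminates \<open>n2\<close>.\<close>
  have "(n1 - (int lam - t * int d)) * (int c - int d) = 0"
    using lin card size by algebra
  then show n1: "int (card (A \<inter> {p \<in> X. replication L p = r1})) = int lam - t * int d"
    using cd by (simp add: n1_def A1_def)
  show "int (card (A \<inter> {p \<in> X. replication L p = r2})) = int lam + t * int c"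
    using n1 card size by (simp add: n1_def n2_def A1_def A2_def algebra_simps)
qed

lemma gt_half_quotient_iff:
  fixes t :: int and c e l :: nat
  assumes "c > 0"
  shows "real_of_int t > (real e - real l) / real c / 2 \<longleftrightarrow> 2 * t * int c + int l > int e"
proof -
  have "real_of_int t > (real e - real l) / real c / 2
      \<longleftrightarrow> real_of_int (2 * t * int c + int l) > real_of_int (int e)"
    using assms by (simp add: field_simps)
  then show ?thesis
    by (simp only: of_int_less_iff)
qed

theorem theorem4p1:
  fixes X :: "'p set" and L :: "'p set set"
    and v lam r1 r2 e1 e2 c d :: nat
    and a :: int and x y :: real
  assumes type2: "ryser_type2 X L v lam"
    and r_order: "r1 > r2"
    and r_sum: "r1 + r2 = v + 1"
    and r_points: "\<forall>p\<in>X. replication L p = r1 \<or> replication L p = r2"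
    and e1: "e1 = card {p \<in> X. replication L p = r1}"
    and e2: "e2 = card {p \<in> X. replication L p = r2}"
    and cd_pos: "c > 0" "d > 0"
    and cd_coprime: "coprime c d"
    and cd_ratio: "(real r1 - 1) / (real r2 - 1) = real c / real d"
    and a: "a = int c - int d"
    and x: "x = (real e2 - real lam) / real c"
    and y: "y = (real e1 - real lam) / real d"
  shows "(\<forall>A\<in>L. \<forall>t::int.
            int (card A) = 2 * int lam + t * a \<and> 2 * t * int c + int lam > int e2 \<longrightarrow>
            {B \<in> L. \<exists>s::int. int (card B) = 2 * int lam + s * a \<and> real_of_int s > x / 2} = {A}) \<and>
         (\<forall>B\<in>L. \<forall>t::int.
            int (card B) = 2 * int lam - t * a \<and> 2 * t * int d + int lam > int e1 \<longrightarrow>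
            {A \<in> L. \<exists>s::int. int (card A) = 2 * int lam - s * a \<and> real_of_int s > y / 2} = {B})"
proof -
  have D: "ryser_design X L v lam"
    using type2 by (simp add: ryser_type2_def)
  note parts = ryser_block_parts[OF D _ r_order r_sum r_points cd_pos cd_ratio, folded a]
  have x_iff: "real_of_int t > x / 2 \<longleftrightarrow> 2 * t * int c + int lam > int e2" for t
    unfolding x by (rule gt_half_quotient_iff[OF cd_pos(1)])
  have y_iff: "real_of_int t > y / 2 \<longleftrightarrow> 2 * t * int d + int lam > int e1" for t
    unfolding y by (rule gt_half_quotient_iff[OF cd_pos(2)])
  have large: "A = B"
    if "A \<in> L" "int (card A) = 2 * int lam + t * a" "2 * t * int c + int lam > int e2"
      "B \<in> L" "int (card B) = 2 * int lam + s * a" "2 * s * int c + int lam > int e2"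
    for A B t s
  proof (rule ryser_block_eqI[OF D])
    show "card (A \<inter> {p \<in> X. replication L p = r2}) + card (B \<inter> {p \<in> X. replication L p = r2})
        > card {p \<in> X. replication L p = r2} + lam"
      \<comment> \<open>The left side is 2 \<lambda> + (t + s) c. Adding the two hypotheses and
        halving gives (t + s) c > \<open>e2\<close> - \<lambda>.\<close>
      using parts(2)[OF that(1,2)] parts(2)[OF that(4,5)] that(3,6) e2 by linarith
  qed (use that in auto)
  have small: "A = B"
    if "A \<in> L" "int (card A) = 2 * int lam - t * a" "2 * t * int d + int lam > int e1"
      "B \<in> L" "int (card B) = 2 * int lam - s * a" "2 * s * int d + int lam > int e1"
    for A B t s
  proof (rule ryser_block_eqI[OF D])
    show "card (A \<inter> {p \<in> X. replication L p = r1}) + card (B \<inter> {p \<in> X. replication L p = r1})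
        > card {p \<in> X. replication L p = r1} + lam"
      \<comment> \<open>Negating the parameters puts the sizes into the form 2 \<lambda> + t a, so
        the two intersections have \<lambda> + t d and \<lambda> + s d points.\<close>
      using parts(1)[OF that(1), of "- t"] parts(1)[OF that(4), of "- s"] that(2,3,5,6) e1 by simp
  qed (use that in auto)
  \<comment> \<open>Both forms of the bound are now the same integer inequality, so the given block
    lies in its own set with witness \<open>s = t\<close>.\<close>
  show ?thesis
    unfolding x_iff y_iff using large small by blast
qed

end
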